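(* Let $\{\xi^k\}_{k\ge0}$ be a sequence generated, from a given $\xi^0\in\mathbb{R}^{(p+1)m}$, by the rank-two relaxed parallel splitting ALM (defined in the context) with $\beta>0$ and $\alpha\in(0,2)$ applied to the problem $\min\{\sum_{i=1}^p\theta_i(x_i) \mid \sum_{i=1}^pA_ix_i=b,\ x_i\in\mathcal{X}_i,\ i=1,\dots,p\}$. Then, for every integer $N>0$, $$\|\xi^N-\xi^{N+1}\|_{\mathcal{H}}^2\le\frac{\alpha}{(2-\alpha)(N+1)}\|\xi^0-\xi^*\|_{\mathcal{H}}^2,\qquad\forall\,\xi^*\in\Xi^*.$$
   Context: Problem and standing assumptions: $p\ge 2$; for $i=1,\dots,p$, $\theta_i:\mathbb{R}^{n_i}\to\mathbb{R}$ is a closed, proper, convex (not necessarily smooth) function, $\mathcal{X}_i\subseteq\mathbb{R}^{n_i}$ is a closed convex set, $A_i\in\mathbb{R}^{m\times n_i}$ has full column rank, and $b\in\mathbb{R}^m$. The solution set of $\min\{\sum_{i=1}^p\theta_i(x_i) \mid \sum_{i=1}^pA_ix_i=b,\ x_i\in\mathcal{X}_i\}$ is nonempty. Notation: $x=(x_1;\dots;x_p)$, $w=(x_1;\dots;x_p;\lambda)$ with $\lambda\in\mathbb{R}^m$, $\theta(x)=\sum_{i=1}^p\theta_i(x_i)$, $\Omega=\mathcal{X}_1\times\cdots\times\mathcal{X}_p\times\mathbb{R}^m$, and $F(w)=(-A_1^T\lambda;\dots;-A_p^T\lambda;\sum_{i=1}^pA_ix_i-b)$. $\Omega^*$ is the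 set of all $w^*=(x_1^*;\dots;x_p^*;\lambda^* )\in\Omega$ such that $\theta(x)-\theta(x^* )+(w-w^* )^TF(w^* )\ge 0$ for all $w\in\Omega$. Let $P=\mathrm{diag}(A_1,\dots,A_p,I_m)$ (block diagonal), so $Pw=(A_1x_1;\dots;A_px_p;\lambda)$, and $\Xi^*=\{Pw^* \mid w^*\in\Omega^*\}$. Matrices ($(p+1)\times(p+1)$ blocks of size $m\times m$): $\mathcal{D}=\mathrm{diag}(\beta I_m,\dots,\beta I_m,\frac1\beta I_m)$ (with $p$ copies of $\beta I_m$); $\mathcal{Q}$ has diagonal blocks $\beta I_m$ in positions $(i,i)$, $i\le p$, block $I_m$ in positions $(i,p+1)$, $i\le p$, block $-I_m$ in positions $(p+1,i)$, $i\le p$, block $\frac1\beta I_m$ in position $(p+1,p+1)$, and zero blocks elsewhere; $\mathcal{M}=\mathcal{Q}^{-T}\mathcal{D}$ and $\mathcal{H}=\mathcal{Q}\mathcal{D}^{-1}\mathcal{Q}^T$. For a symmetric positive definite matrix $G$, $\|\xi\|_G^2=\xi^TG\xi$. Algorithm (rank-two relaxed parallel splitting ALM): given $\xi^k=(\xi^k_1;\dots;\xi^k_p;\lambda^k)\in\mathbb{R}^{(p+1)m}$ (the block $\xi_i^k\in\mathbb{R}^m$ is the quantity denoted "$A_ix_i^k$"), compute for $i=1,\dots,p$ $$\tilde x_i^k\in\arg\min\Big\{\theta_i(x_i)-(\lambda^k)^TA_ix_i+\tfrac{\beta}{2}\|A_ix_i-\xi_i^k\|^2 \;\Big|\; x_i\in\mathcal{X}_i\Big\},\qquad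 \tilde\lambda^k=\lambda^k-\beta\Big(\sum_{i=1}^p\xi_i^k-b\Big),$$ set $\tilde w^k=(\tilde x_1^k;\dots;\tilde x_p^k;\tilde\lambda^k)$, $\tilde\xi^k=P\tilde w^k$, and $\xi^{k+1}=\xi^k-\alpha\mathcal{M}(\xi^k-\tilde\xi^k)$, where $\alpha\in(0,2)$. *)

theory Defs
  imports "HOL-Analysis.Analysis"
begin

text \<open>
  Encoding. The block numbers \<open>1, \<dots>, p\<close> are the elements of a finite type \<open>'p\<close>, and the
  \<open>p + 1\<close> block positions of the matrices below are the elements of \<open>'p option\<close>, with \<open>None\<close>
  standing for position \<open>p + 1\<close> (the multiplier). The dimensions \<open>n\<^sub>i\<close> may differ from block to
  block, so \<open>\<real>\<close> to the power \<open>n\<^sub>i\<close> is the coordinate subspace of \<open>real ^ 'n\<close> spanned by the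
  coordinates in a set \<open>J i\<close> with \<open>n\<^sub>i = card (J i)\<close>; an \<open>m \<times> n\<^sub>i\<close> matrix is a
  \<open>real ^ 'n ^ 'm\<close> whose columns outside \<open>J i\<close> vanish.
\<close>

definition coord_space :: "'n set \<Rightarrow> (real ^ 'n) set" where
  "coord_space J = {x. \<forall>j. j \<notin> J \<longrightarrow> x $ j = 0}"

definition full_column_rank_on :: "'n set \<Rightarrow> real ^ 'n ^ 'm \<Rightarrow> bool" where
  "full_column_rank_on J A \<longleftrightarrow> (\<forall>j. j \<notin> J \<longrightarrow> column j A = 0) \<and> rank A = card J"

definition proper_on :: "'a set \<Rightarrow> ('a \<Rightarrow> ereal) \<Rightarrow> bool" where
  "proper_on S f \<longleftrightarrow> (\<exists>x\<in>S. f x < \<infinity>) \<and> (\<forall>x\<in>S. - \<infinity> < f x)"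

definition closed_fun_on :: "'a::real_normed_vector set \<Rightarrow> ('a \<Rightarrow> real) \<Rightarrow> bool" where
  "closed_fun_on S f \<longleftrightarrow> closed (epigraph S f)"

type_synonym ('n, 'p) primal = "((real, 'n) vec, 'p) vec"
type_synonym ('n, 'p, 'm) primal_dual = "((real, 'n) vec, 'p) vec \<times> (real, 'm) vec"
type_synonym ('p, 'm) blockvec = "(real, 'p option \<times> 'm) vec"
type_synonym ('p, 'm) blockmat = "((real, 'p option \<times> 'm) vec, 'p option \<times> 'm) vec"

definition total_objective ::
  "('p::finite \<Rightarrow> real ^ 'n \<Rightarrow> real) \<Rightarrow> ('n::finite, 'p) primal \<Rightarrow> real" where
  "total_objective \<theta> x = (\<Sum>i\<in>UNIV. \<theta> i (x $ i))"

definition feasible ::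
  "('p::finite \<Rightarrow> (real ^ 'n) set) \<Rightarrow> ('p \<Rightarrow> real ^ 'n ^ 'm) \<Rightarrow> real ^ 'm \<Rightarrow>
   ('n::finite, 'p) primal \<Rightarrow> bool" where
  "feasible X A b x \<longleftrightarrow> (\<Sum>i\<in>UNIV. A i *v (x $ i)) = b \<and> (\<forall>i. x $ i \<in> X i)"

definition Omega ::
  "('p::finite \<Rightarrow> (real ^ 'n) set) \<Rightarrow> ('n::finite, 'p, 'm::finite) primal_dual set" where
  "Omega X = {w. \<forall>i. fst w $ i \<in> X i}"

definition VI_op ::
  "('p::finite \<Rightarrow> real ^ 'n ^ 'm) \<Rightarrow> real ^ 'm \<Rightarrow>
   ('n::finite, 'p, 'm::finite) primal_dual \<Rightarrow> ('n, 'p, 'm) primal_dual" where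
  "VI_op A b w = ((\<chi> i. - (transpose (A i) *v snd w)), (\<Sum>i\<in>UNIV. A i *v (fst w $ i)) - b)"

definition Omega_star ::
  "('p::finite \<Rightarrow> real ^ 'n \<Rightarrow> real) \<Rightarrow> ('p \<Rightarrow> (real ^ 'n) set) \<Rightarrow> ('p \<Rightarrow> real ^ 'n ^ 'm) \<Rightarrow>
   real ^ 'm \<Rightarrow> ('n::finite, 'p, 'm::finite) primal_dual set" where
  "Omega_star \<theta> X A b = {ws \<in> Omega X. \<forall>w \<in> Omega X.
     total_objective \<theta> (fst w) - total_objective \<theta> (fst ws) + (w - ws) \<bullet> VI_op A b ws \<ge> 0}"

definition block :: "'p option \<Rightarrow> ('p::finite, 'm::finite) blockvec \<Rightarrow> real ^ 'm" where
  "block c \<xi> = (\<chi> r. \<xi> $ (c, r))"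

definition stack :: "('p option \<Rightarrow> real ^ 'm) \<Rightarrow> ('p::finite, 'm::finite) blockvec" where
  "stack v = (\<chi> cr. v (fst cr) $ snd cr)"

definition block_matrix ::
  "('p option \<Rightarrow> 'p option \<Rightarrow> real ^ 'm ^ 'm) \<Rightarrow> ('p::finite, 'm::finite) blockmat" where
  "block_matrix B = (\<chi> r c. B (fst r) (fst c) $ snd r $ snd c)"

text \<open>The action \<open>w \<mapsto> (A\<^sub>1 x\<^sub>1; \<dots>; A\<^sub>p x\<^sub>p; \<lambda>)\<close> of the block diagonal matrix \<open>diag(A\<^sub>1, \<dots>, A\<^sub>p, I)\<close>.\<close>

definition P_map ::
  "('p::finite \<Rightarrow> real ^ 'n ^ 'm) \<Rightarrow> ('n::finite, 'p, 'm::finite) primal_dual \<Rightarrow>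
   ('p, 'm) blockvec" where
  "P_map A w = stack (\<lambda>c. case c of Some i \<Rightarrow> A i *v (fst w $ i) | None \<Rightarrow> snd w)"

definition Xi_star ::
  "('p::finite \<Rightarrow> real ^ 'n \<Rightarrow> real) \<Rightarrow> ('p \<Rightarrow> (real ^ 'n) set) \<Rightarrow>
   ('p \<Rightarrow> real ^ ('n::finite) ^ 'm) \<Rightarrow> real ^ 'm \<Rightarrow> ('p, 'm::finite) blockvec set" where
  "Xi_star \<theta> X A b = P_map A ` Omega_star \<theta> X A b"

text \<open>In the following two matrices, \<open>mat k\<close> is \<open>k\<close> times the \<open>m \<times> m\<close> identity matrix.\<close>

definition D_mat :: "real \<Rightarrow> ('p::finite, 'm::finite) blockmat" where
  "D_mat \<beta> = block_matrix (\<lambda>r c. case (r, c) of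
      (Some i, Some j) \<Rightarrow> if i = j then mat \<beta> else 0
    | (None, None) \<Rightarrow> mat (1 / \<beta>)
    | _ \<Rightarrow> 0)"

definition Q_mat :: "real \<Rightarrow> ('p::finite, 'm::finite) blockmat" where
  "Q_mat \<beta> = block_matrix (\<lambda>r c. case (r, c) of
      (Some i, Some j) \<Rightarrow> if i = j then mat \<beta> else 0
    | (Some i, None) \<Rightarrow> mat 1
    | (None, Some j) \<Rightarrow> - mat 1
    | (None, None) \<Rightarrow> mat (1 / \<beta>))"

definition M_mat :: "real \<Rightarrow> ('p::finite, 'm::finite) blockmat" where
  "M_mat \<beta> = matrix_inv (transpose (Q_mat \<beta>)) ** D_mat \<beta>"

definition H_mat :: "real \<Rightarrow> ('p::finite, 'm::finite) blockmat" where
  "H_mat \<beta> = Q_mat \<beta> ** matrix_inv (D_mat \<beta>) ** transpose (Q_mat \<beta>)"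

definition norm_sq :: "real ^ 'k ^ 'k \<Rightarrow> real ^ ('k::finite) \<Rightarrow> real" where
  "norm_sq G \<xi> = \<xi> \<bullet> (G *v \<xi>)"

text \<open>
  One iteration, as a relation between \<open>\<xi>\<close> and its successor \<open>\<xi>'\<close>: the subproblems may have
  several minimisers as far as the definition is concerned, so any choice \<open>xt\<close> of minimisers
  is admitted.
\<close>

definition psalm_step ::
  "('p::finite \<Rightarrow> real ^ 'n \<Rightarrow> real) \<Rightarrow> ('p \<Rightarrow> (real ^ 'n) set) \<Rightarrow>
   ('p \<Rightarrow> real ^ ('n::finite) ^ 'm) \<Rightarrow> real ^ 'm \<Rightarrow> real \<Rightarrow> real \<Rightarrow>
   ('p, 'm::finite) blockvec \<Rightarrow> ('p, 'm) blockvec \<Rightarrow> bool" where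
  "psalm_step \<theta> X A b \<beta> \<alpha> \<xi> \<xi>' \<longleftrightarrow>
    (\<exists>(xt :: ('n, 'p) primal) lt.
      (\<forall>i. is_arg_min
             (\<lambda>x. \<theta> i x - block None \<xi> \<bullet> (A i *v x)
                    + \<beta> / 2 * (norm (A i *v x - block (Some i) \<xi>))\<^sup>2)
             (\<lambda>x. x \<in> X i) (xt $ i)) \<and>
      lt = block None \<xi> - \<beta> *\<^sub>R ((\<Sum>i\<in>UNIV. block (Some i) \<xi>) - b) \<and>
      \<xi>' = \<xi> - \<alpha> *\<^sub>R (M_mat \<beta> *v (\<xi> - P_map A (xt, lt))))"

end

theory Submission
  imports Defs
begin

text \<open>
  Write \<open>e\<^sup>k = \<xi>\<^sup>k - \<xi>'\<^sup>k\<close> for the difference between the iterate and its prediction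
  \<open>\<xi>'\<^sup>k = P w'\<^sup>k\<close>. The optimality conditions of the subproblems and the multiplier update together
  say that \<open>w'\<^sup>k\<close> solves the variational inequality that defines \<open>\<Omega>\<^sup>*\<close> with its right-hand side
  \<open>0\<close> replaced by \<open>(P w - P w'\<^sup>k) \<bullet> Q e\<^sup>k\<close> (lemma \<open>psalm_step_solves_VI\<close>). Since \<open>F\<close> is affine with a
  skew linear part, two perturbed solutions \<open>w\<^sub>1\<close>, \<open>w\<^sub>2\<close> with perturbations \<open>g\<^sub>1\<close>, \<open>g\<^sub>2\<close>
  satisfy \<open>(P w\<^sub>1 - P w\<^sub>2) \<bullet> (g\<^sub>1 - g\<^sub>2) \<ge> 0\<close> (lemma \<open>solves_VI_monotone\<close>). Taking for the second
  solution either an exact one, with \<open>g\<^sub>2 = 0\<close>, or the next prediction gives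

  \<^item> \<open>(\<xi>'\<^sup>k - \<xi>\<^sup>*) \<bullet> Q e\<^sup>k \<ge> 0\<close>, and
  \<^item> \<open>(\<xi>'\<^sup>k - \<xi>'\<^sup>k\<^sup>+\<^sup>1) \<bullet> Q (e\<^sup>k - e\<^sup>k\<^sup>+\<^sup>1) \<ge> 0\<close>.

  What remains is linear algebra. The matrices are built so that \<open>Q + Q\<^sup>T = 2 D\<close>, \<open>H M = Q\<close> and
  \<open>Q\<^sup>T M = D\<close>. Hence \<open>e \<bullet> Q e = e \<bullet> D e\<close>, and a step \<open>\<alpha> M e\<close> has squared \<open>H\<close>-length
  \<open>\<alpha>\<^sup>2 (e \<bullet> D e)\<close>. The first inequality then yields
  \<open>\<parallel>\<xi>\<^sup>k\<^sup>+\<^sup>1 - \<xi>\<^sup>*\<parallel>\<^sup>2 \<le> \<parallel>\<xi>\<^sup>k - \<xi>\<^sup>*\<parallel>\<^sup>2 - \<alpha> (2 - \<alpha>) (e\<^sup>k \<bullet> D e\<^sup>k)\<close> in the \<open>H\<close>-norm, and the second that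
  \<open>e\<^sup>k \<bullet> D e\<^sup>k\<close> is nonincreasing. Summing over \<open>k \<le> N\<close> and replacing every
  \<open>e\<^sup>k \<bullet> D e\<^sup>k\<close> by the smallest of them, the last one, gives the rate
  (lemma \<open>prediction_correction_rate\<close>).
\<close>

section \<open>Prediction-correction schemes\<close>

\<comment> \<open>Transposes stay on the left of vectors, so that the matrix identities below apply.\<close>
declare transpose_matrix_vector [simp del]

lemma inner_matrix_swap: "x \<bullet> (G *v y) = (transpose G *v x) \<bullet> (y :: real ^ 'k)"
  for G :: "real ^ 'k ^ 'k"
  by (simp add: transpose_matrix_vector dot_lmul_matrix)

lemma pos_def_invertible:
  fixes G :: "real ^ 'k ^ 'k"
  assumes "\<And>x. x \<noteq> 0 \<Longrightarrow> x \<bullet> (G *v x) > 0"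
  shows "invertible G"
proof -
  have "x = 0" if "G *v x = 0" for x
    using assms[of x] that by fastforce
  then show ?thesis
    by (simp add: invertible_left_inverse matrix_left_invertible_ker)
qed

lemma matrix_inv_vec:
  fixes G :: "real ^ 'k ^ 'k"
  assumes "invertible G"
  shows "G *v (matrix_inv G *v x) = x" "matrix_inv G *v (G *v x) = x"
proof -
  have "G ** matrix_inv G = mat 1 \<and> matrix_inv G ** G = mat 1"
    using assms unfolding matrix_inv_def invertible_def by (rule someI_ex)
  then show "G *v (matrix_inv G *v x) = x" "matrix_inv G *v (G *v x) = x"
    by (simp_all add: matrix_vector_mul_assoc)
qed

text \<open>
  The rate only depends on how the four matrices are related. The perturbations \<open>Q e\<close> enter
  through monotonicity, the corrections \<open>M e\<close> through the update, and \<open>H\<close> is the metric in which the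
  two fit together: \<open>x \<bullet> H (M e) = x \<bullet> Q e\<close>.
\<close>

locale prediction_correction =
  fixes Q D M H :: "real ^ 'k ^ 'k"
  assumes D_pos: "\<And>x. x \<noteq> 0 \<Longrightarrow> x \<bullet> (D *v x) > 0"
    and D_sym: "transpose D = D"
    and Q_sym_part: "\<And>x. x \<bullet> (Q *v x) = x \<bullet> (D *v x)"
    and M_eq: "M = matrix_inv (transpose Q) ** D"
    and H_eq: "H = Q ** matrix_inv D ** transpose Q"
begin

lemma D_nonneg: "x \<bullet> (D *v x) \<ge> 0"
  using D_pos[of x] by (cases "x = 0") auto

lemma D_swap: "x \<bullet> (D *v y) = y \<bullet> (D *v x)"
  using inner_matrix_swap[of x D y] by (simp add: D_sym inner_commute)

lemma invertible_D: "invertible D"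
  using D_pos by (rule pos_def_invertible)

lemma invertible_Q_transpose: "invertible (transpose Q)"
proof (rule pos_def_invertible)
  fix x :: "real ^ 'k"
  assume "x \<noteq> 0"
  then show "x \<bullet> (transpose Q *v x) > 0"
    using D_pos[of x] Q_sym_part[of x] inner_matrix_swap[of x Q x] by (simp add: inner_commute)
qed

lemma Q_transpose_M: "transpose Q *v (M *v x) = D *v x"
  by (simp add: M_eq matrix_inv_vec(1)[OF invertible_Q_transpose] flip: matrix_vector_mul_assoc)

lemma H_M: "H *v (M *v x) = Q *v x"
proof -
  have "H *v (M *v x) = Q *v (matrix_inv D *v (transpose Q *v (M *v x)))"
    by (simp add: H_eq flip: matrix_vector_mul_assoc)
  then show ?thesis
    by (simp add: Q_transpose_M matrix_inv_vec(2)[OF invertible_D])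
qed

lemma H_inner:
  "x \<bullet> (H *v y) =
    (matrix_inv D *v (transpose Q *v x)) \<bullet> (D *v (matrix_inv D *v (transpose Q *v y)))"
proof -
  let ?K = "\<lambda>x. matrix_inv D *v (transpose Q *v x)"
  have "x \<bullet> (H *v y) = (transpose Q *v x) \<bullet> ?K y"
    by (simp add: H_eq inner_matrix_swap[of x Q] flip: matrix_vector_mul_assoc)
  also have "\<dots> = (D *v ?K x) \<bullet> ?K y"
    by (simp add: matrix_inv_vec(1)[OF invertible_D])
  also have "\<dots> = ?K x \<bullet> (D *v ?K y)"
    by (simp add: inner_matrix_swap[of "?K x" D] D_sym)
  finally show ?thesis .
qed

lemma H_swap: "x \<bullet> (H *v y) = y \<bullet> (H *v x)"
  unfolding H_inner by (rule D_swap)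

lemma norm_sq_H_nonneg: "norm_sq H x \<ge> 0"
  unfolding norm_sq_def H_inner by (rule D_nonneg)

lemma norm_sq_H_correction: "norm_sq H (a *\<^sub>R (M *v e)) = a\<^sup>2 * norm_sq D e"
proof -
  have "norm_sq H (a *\<^sub>R (M *v e)) = a\<^sup>2 * ((M *v e) \<bullet> (Q *v e))"
    by (simp add: norm_sq_def H_M matrix_vector_mult_scaleR power2_eq_square)
  also have "(M *v e) \<bullet> (Q *v e) = norm_sq D e"
    by (simp add: inner_matrix_swap[of _ Q] Q_transpose_M norm_sq_def inner_commute)
  finally show ?thesis .
qed

lemma norm_sq_H_diff:
  "norm_sq H (x - a *\<^sub>R (M *v e)) = norm_sq H x - 2 * a * (x \<bullet> (Q *v e)) + a\<^sup>2 * norm_sq D e"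
proof -
  let ?y = "a *\<^sub>R (M *v e)"
  have "norm_sq H (x - ?y) = norm_sq H x - 2 * (x \<bullet> (H *v ?y)) + norm_sq H ?y"
    using H_swap[of x ?y]
    by (simp add: norm_sq_def matrix_vector_mult_diff_distrib inner_diff_left inner_diff_right)
  also have "x \<bullet> (H *v ?y) = a * (x \<bullet> (Q *v e))"
    by (simp add: matrix_vector_mult_scaleR H_M)
  finally show ?thesis by (simp add: norm_sq_H_correction)
qed

text \<open>
  Moving from the prediction back to the iterate adds \<open>e \<bullet> Q e = e \<bullet> D e\<close> to a nonnegative number,
  which beats the quadratic term of the step as long as \<open>\<alpha> < 2\<close>.
\<close>

lemma contraction:
  assumes "(x - e - s) \<bullet> (Q *v e) \<ge> 0" and "\<alpha> \<ge> 0"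
  shows "norm_sq H (x - \<alpha> *\<^sub>R (M *v e) - s) \<le> norm_sq H (x - s) - \<alpha> * (2 - \<alpha>) * norm_sq D e"
proof -
  have "norm_sq D e \<le> (x - s) \<bullet> (Q *v e)"
    using assms(1) Q_sym_part[of e] by (simp add: norm_sq_def inner_diff_left)
  from mult_left_mono[OF this \<open>\<alpha> \<ge> 0\<close>] show ?thesis
    using norm_sq_H_diff[of "x - s" \<alpha> e]
    by (simp add: algebra_simps power2_eq_square)
qed

text \<open>
  With \<open>d = e - e'\<close>, monotonicity turns into \<open>d \<bullet> D d \<le> \<alpha> (e \<bullet> D d)\<close>, because the iterates
  differ by \<open>\<alpha> M e\<close> and \<open>M e \<bullet> Q d = e \<bullet> D d\<close>. Expanding the square of \<open>e' = e - d\<close> then leaves a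
  decrease of at least \<open>(2 / \<alpha> - 1) (d \<bullet> D d)\<close>.
\<close>

lemma residual_decreases:
  assumes mono: "((x - e) - (x - \<alpha> *\<^sub>R (M *v e) - e')) \<bullet> (Q *v e - Q *v e') \<ge> 0"
    and "0 < \<alpha>" "\<alpha> < 2"
  shows "norm_sq D e' \<le> norm_sq D e"
proof -
  define d where "d = e - e'"
  have "(\<alpha> *\<^sub>R (M *v e) - d) \<bullet> (Q *v d) \<ge> 0"
    using mono by (simp add: d_def matrix_vector_mult_diff_distrib algebra_simps)
  moreover have "(M *v e) \<bullet> (Q *v d) = e \<bullet> (D *v d)"
    by (simp add: inner_matrix_swap[of "M *v e" Q] Q_transpose_M inner_matrix_swap[of e D] D_sym)
  ultimately have d_le: "norm_sq D d \<le> \<alpha> * (e \<bullet> (D *v d))"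
    using Q_sym_part[of d] by (simp add: norm_sq_def inner_diff_left)
  have "norm_sq D d \<ge> 0"
    by (simp add: norm_sq_def D_nonneg)
  with d_le \<open>0 < \<alpha>\<close> have "0 \<le> e \<bullet> (D *v d)"
    by (metis order_trans zero_le_mult_iff not_le)
  then have "\<alpha> * (e \<bullet> (D *v d)) \<le> 2 * (e \<bullet> (D *v d))"
    using \<open>\<alpha> < 2\<close> by (intro mult_right_mono) auto
  moreover have "norm_sq D e' = norm_sq D e - 2 * (e \<bullet> (D *v d)) + norm_sq D d"
    using D_swap[of e e']
    by (simp add: norm_sq_def d_def matrix_vector_mult_diff_distrib inner_diff_left inner_diff_right)
  ultimately show ?thesis using d_le by linarith
qed

lemma prediction_correction_rate:
  fixes \<xi> e :: "nat \<Rightarrow> real ^ 'k"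
  assumes step: "\<And>k. \<xi> (Suc k) = \<xi> k - \<alpha> *\<^sub>R (M *v e k)"
    and sol: "\<And>k. (\<xi> k - e k - s) \<bullet> (Q *v e k) \<ge> 0"
    and mono: "\<And>k. ((\<xi> k - e k) - (\<xi> (Suc k) - e (Suc k))) \<bullet> (Q *v e k - Q *v e (Suc k)) \<ge> 0"
    and \<alpha>: "0 < \<alpha>" "\<alpha> < 2"
  shows "norm_sq H (\<xi> N - \<xi> (Suc N)) \<le> \<alpha> / ((2 - \<alpha>) * (real N + 1)) * norm_sq H (\<xi> 0 - s)"
proof -
  have "norm_sq D (e (Suc k)) \<le> norm_sq D (e k)" for k
    using mono[of k] \<alpha> unfolding step by (rule residual_decreases)
  then have e_le: "norm_sq D (e N) \<le> norm_sq D (e k)" if "k \<le> N" for k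
    using that by (rule lift_Suc_antimono_le)
  have contr: "norm_sq H (\<xi> (Suc k) - s) \<le> norm_sq H (\<xi> k - s) - \<alpha> * (2 - \<alpha>) * norm_sq D (e k)" for k
    using contraction[OF sol] \<alpha> by (simp add: step)
  have "norm_sq H (\<xi> n - s) + real n * (\<alpha> * (2 - \<alpha>) * norm_sq D (e N)) \<le> norm_sq H (\<xi> 0 - s)"
    if "n \<le> Suc N" for n
    using that
  proof (induction n)
    case (Suc n)
    have "\<alpha> * (2 - \<alpha>) * norm_sq D (e N) \<le> \<alpha> * (2 - \<alpha>) * norm_sq D (e n)"
      using \<alpha> e_le[of n] Suc.prems by (intro mult_left_mono) auto
    with Suc contr[of n] show ?case by (simp add: algebra_simps)
  qed simp
  from this[of "Suc N"]
  have bound: "(real N + 1) * (\<alpha> * (2 - \<alpha>) * norm_sq D (e N)) \<le> norm_sq H (\<xi> 0 - s)"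
    using norm_sq_H_nonneg[of "\<xi> (Suc N) - s"] by (simp add: algebra_simps)
  have "norm_sq H (\<xi> N - \<xi> (Suc N)) = \<alpha>\<^sup>2 * norm_sq D (e N)"
    by (simp add: step norm_sq_H_correction)
  also have "\<dots> = \<alpha> / ((2 - \<alpha>) * (real N + 1)) * ((real N + 1) * (\<alpha> * (2 - \<alpha>) * norm_sq D (e N)))"
  proof -
    have "2 - \<alpha> \<noteq> 0" "real N + 1 \<noteq> 0" using \<alpha> by auto
    then show ?thesis by (simp add: power2_eq_square)
  qed
  also have "\<dots> \<le> \<alpha> / ((2 - \<alpha>) * (real N + 1)) * norm_sq H (\<xi> 0 - s)"
    using bound \<alpha> by (intro mult_left_mono) auto
  finally show ?thesis .
qed

end

section \<open>Block vectors and the matrices of the method\<close>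

lemma sum_option:
  fixes f :: "'p::finite option \<Rightarrow> 'a::comm_monoid_add"
  shows "(\<Sum>c\<in>UNIV. f c) = f None + (\<Sum>i\<in>UNIV. f (Some i))"
  by (simp add: UNIV_option_conv sum.reindex)

lemma block_diff: "block c (x - y) = block c x - block c y"
  by (simp add: block_def vec_eq_iff)

lemma block_zero: "block c 0 = 0"
  by (simp add: block_def vec_eq_iff)

lemma block_P_map:
  "block None (P_map A w) = snd w" "block (Some i) (P_map A w) = A i *v (fst w $ i)"
  by (simp_all add: P_map_def block_def stack_def vec_eq_iff)

lemma blockvec_eqI: "(\<And>c. block c x = block c y) \<Longrightarrow> x = y"
  by (simp add: block_def vec_eq_iff)

lemma inner_blockvec:
  "x \<bullet> y = block None x \<bullet> block None y + (\<Sum>i\<in>UNIV. block (Some i) x \<bullet> block (Some i) y)"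
proof -
  have "x \<bullet> y = (\<Sum>c\<in>UNIV. block c x \<bullet> block c y)"
    by (simp add: inner_vec_def block_def sum.cartesian_product)
  then show ?thesis by (simp add: sum_option)
qed

lemma block_block_matrix_mult:
  "block c (block_matrix B *v x) =
    B c None *v block None x + (\<Sum>j\<in>UNIV. B c (Some j) *v block (Some j) x)"
proof -
  have "block c (block_matrix B *v x) = (\<Sum>d\<in>UNIV. B c d *v block d x)"
    by (simp add: vec_eq_iff block_def block_matrix_def matrix_vector_mult_def sum.cartesian_product
        case_prod_beta)
  then show ?thesis by (simp add: sum_option)
qed

lemma mat_mult_vec: "mat k *v x = k *\<^sub>R (x :: real ^ 'm)"
  by (simp add: vec_eq_iff matrix_vector_mult_def mat_def if_distrib[of "\<lambda>c. c * _"] cong: if_cong)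

lemma mat_mult_delta:
  "(\<Sum>j\<in>UNIV. (if i = j then mat k else 0) *v v j) = k *\<^sub>R (v i :: real ^ 'm)" for i :: "'p::finite"
proof -
  have "(\<Sum>j\<in>UNIV. (if i = j then mat k else 0) *v v j) = (\<Sum>j\<in>UNIV. if i = j then mat k *v v j else 0)"
    by (intro sum.cong) auto
  then show ?thesis by (simp add: mat_mult_vec)
qed

lemma uminus_matrix_vector_mult: "(- G) *v x = - (G *v x)" for G :: "real ^ 'k ^ 'm"
  by (simp add: vec_eq_iff matrix_vector_mult_def sum_negf)

lemma block_D_mat:
  "block None (D_mat \<beta> *v x) = (1 / \<beta>) *\<^sub>R block None x"
  "block (Some i) (D_mat \<beta> *v x) = \<beta> *\<^sub>R block (Some i) x"
  by (simp_all add: D_mat_def block_block_matrix_mult mat_mult_vec mat_mult_delta)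

lemma block_Q_mat:
  "block None (Q_mat \<beta> *v x) = (1 / \<beta>) *\<^sub>R block None x - (\<Sum>j\<in>UNIV. block (Some j) x)"
  "block (Some i) (Q_mat \<beta> *v x) = \<beta> *\<^sub>R block (Some i) x + block None x"
  by (simp_all add: Q_mat_def block_block_matrix_mult mat_mult_vec mat_mult_delta
      uminus_matrix_vector_mult sum_negf)

lemma transpose_D_mat: "transpose (D_mat \<beta>) = D_mat \<beta>"
  by (auto simp: D_mat_def block_matrix_def transpose_def vec_eq_iff mat_def split: option.split)

lemma prediction_correction_psalm:
  assumes "\<beta> > 0"
  shows "prediction_correction (Q_mat \<beta>) (D_mat \<beta>) (M_mat \<beta>) (H_mat \<beta> :: ('p::finite, 'm::finite) blockmat)"
proof
  fix x :: "('p, 'm) blockvec"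
  have D: "x \<bullet> (D_mat \<beta> *v x) =
      (1 / \<beta>) * (block None x \<bullet> block None x)
        + \<beta> * (\<Sum>i\<in>UNIV. block (Some i) x \<bullet> block (Some i) x)"
    by (simp add: inner_blockvec block_D_mat sum_distrib_left)
  \<comment> \<open>The off-diagonal blocks \<open>I\<close> and \<open>-I\<close> cancel in the quadratic form.\<close>
  have "block None x \<bullet> (\<Sum>i\<in>UNIV. block (Some i) x) = (\<Sum>i\<in>UNIV. block (Some i) x \<bullet> block None x)"
    by (simp add: inner_sum_right inner_commute)
  then show "x \<bullet> (Q_mat \<beta> *v x) = x \<bullet> (D_mat \<beta> *v x)"
    unfolding D
    by (simp add: inner_blockvec block_Q_mat inner_diff_right inner_add_right sum.distrib
        sum_distrib_left)
  show "x \<bullet> (D_mat \<beta> *v x) > 0" if "x \<noteq> 0"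
  proof -
    have "\<exists>c. block c x \<noteq> 0"
      using that blockvec_eqI[of x 0] unfolding block_zero by blast
    then obtain c where c: "block c x \<noteq> 0" ..
    show ?thesis
    proof (cases c)
      case None
      with c have "(1 / \<beta>) * (block None x \<bullet> block None x) > 0"
        using assms by simp
      moreover have "\<beta> * (\<Sum>i\<in>UNIV. block (Some i) x \<bullet> block (Some i) x) \<ge> 0"
        using assms by (intro mult_nonneg_nonneg sum_nonneg) auto
      ultimately show ?thesis unfolding D by linarith
    next
      case (Some i)
      with c have "(\<Sum>i\<in>UNIV. block (Some i) x \<bullet> block (Some i) x) > 0"
        by (intro sum_pos2[of _ i]) auto
      then show ?thesis
        unfolding D using assms by (simp add: add_nonneg_pos)
    qed
  qed
qed (simp_all add: transpose_D_mat M_mat_def H_mat_def)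

section \<open>The perturbed variational inequality\<close>

text \<open>The elements of \<open>Omega_star\<close> are the solutions for \<open>g = 0\<close>.\<close>

definition solves_VI ::
  "('p::finite \<Rightarrow> real ^ 'n \<Rightarrow> real) \<Rightarrow> ('p \<Rightarrow> (real ^ 'n) set) \<Rightarrow> ('p \<Rightarrow> real ^ 'n ^ 'm) \<Rightarrow>
   real ^ 'm \<Rightarrow> ('p, 'm) blockvec \<Rightarrow> ('n::finite, 'p, 'm::finite) primal_dual \<Rightarrow> bool" where
  "solves_VI \<theta> X A b g v \<longleftrightarrow> v \<in> Omega X \<and> (\<forall>w \<in> Omega X.
     total_objective \<theta> (fst w) - total_objective \<theta> (fst v) + (w - v) \<bullet> VI_op A b v
       \<ge> (P_map A w - P_map A v) \<bullet> g)"

lemma Omega_star_solves_VI: "w \<in> Omega_star \<theta> X A b \<longleftrightarrow> solves_VI \<theta> X A b 0 w"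
  by (simp add: Omega_star_def solves_VI_def)

lemma inner_VI_op:
  "u \<bullet> VI_op A b v =
    snd u \<bullet> ((\<Sum>i\<in>UNIV. A i *v (fst v $ i)) - b) - (\<Sum>i\<in>UNIV. (A i *v (fst u $ i)) \<bullet> snd v)"
proof -
  have "(fst u $ i) \<bullet> (transpose (A i) *v snd v) = (A i *v (fst u $ i)) \<bullet> snd v" for i
    by (metis dot_lmul_matrix inner_commute vector_transpose_matrix transpose_transpose)
  then show ?thesis
    by (simp add: VI_op_def inner_prod_def inner_vec_def[of "fst u"] sum_negf)
qed

text \<open>The linear part of the operator of the variational inequality is skew.\<close>

lemma VI_op_skew:
  fixes v w :: "('n::finite, 'p::finite, 'm::finite) primal_dual"
  shows "(w - v) \<bullet> VI_op A b v + (v - w) \<bullet> VI_op A b w = 0"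
proof -
  have *: "(\<Sum>i\<in>UNIV. (A i *v (fst u $ i)) \<bullet> l) = l \<bullet> (\<Sum>i\<in>UNIV. A i *v (fst u $ i))"
    for u :: "('n, 'p, 'm) primal_dual" and l
    by (simp add: inner_sum_right inner_commute)
  show ?thesis
    unfolding inner_VI_op *
    by (simp add: matrix_vector_mult_diff_distrib sum_subtractf inner_diff_left inner_diff_right
        inner_commute)
qed

lemma solves_VI_monotone:
  assumes "solves_VI \<theta> X A b g v" and "solves_VI \<theta> X A b h w"
  shows "(P_map A v - P_map A w) \<bullet> (g - h) \<ge> 0"
proof -
  have "(P_map A w - P_map A v) \<bullet> g
      \<le> total_objective \<theta> (fst w) - total_objective \<theta> (fst v) + (w - v) \<bullet> VI_op A b v"
    and "(P_map A v - P_map A w) \<bullet> h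
      \<le> total_objective \<theta> (fst v) - total_objective \<theta> (fst w) + (v - w) \<bullet> VI_op A b w"
    using assms by (auto simp: solves_VI_def)
  then show ?thesis
    using VI_op_skew[of w v A b] by (simp add: inner_diff_left inner_diff_right)
qed

text \<open>
  First-order optimality without differentiating \<open>f\<close>: comparing the minimiser with the points
  \<open>x + t (y - x)\<close> and dividing by \<open>t\<close> leaves the asserted inequality up to an error of order \<open>t\<close>.
\<close>

lemma prox_optimality:
  fixes G :: "real ^ 'n ^ 'm"
  assumes f: "convex_on S f" and S: "S' \<subseteq> S" "convex S'"
    and x: "is_arg_min (\<lambda>x. f x - l \<bullet> (G *v x) + \<beta> / 2 * (norm (G *v x - a))\<^sup>2) (\<lambda>x. x \<in> S') x"
    and y: "y \<in> S'"
  shows "f y - f x \<ge> (G *v y - G *v x) \<bullet> (l + \<beta> *\<^sub>R (a - G *v x))"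
proof -
  let ?d = "G *v y - G *v x"
  have xS: "x \<in> S'" using x by (simp add: is_arg_min_def)
  have le: "?d \<bullet> (l + \<beta> *\<^sub>R (a - G *v x)) \<le> f y - f x + t * (\<beta> / 2 * (?d \<bullet> ?d))"
    if t: "0 < t" "t < 1" for t
  proof -
    define z where "z = (1 - t) *\<^sub>R x + t *\<^sub>R y"
    have "z \<in> S'"
      using S(2) xS y t by (auto simp: z_def convex_alt)
    then have min: "f x - l \<bullet> (G *v x) + \<beta> / 2 * (norm (G *v x - a))\<^sup>2
        \<le> f z - l \<bullet> (G *v z) + \<beta> / 2 * (norm (G *v z - a))\<^sup>2"
      using x by (auto simp: is_arg_min_linorder)
    have fz: "f z \<le> (1 - t) * f x + t * f y"
      using convex_onD[OF f, of t x y] t xS y S(1) by (auto simp: z_def)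
    have Gz: "G *v z = G *v x + t *\<^sub>R ?d"
      by (simp add: z_def matrix_vector_right_distrib matrix_vector_mult_scaleR algebra_simps)
    have sq: "(norm (G *v z - a))\<^sup>2 =
        (norm (G *v x - a))\<^sup>2 - 2 * t * (?d \<bullet> (a - G *v x)) + t\<^sup>2 * (?d \<bullet> ?d)"
    proof -
      have "G *v z - a = (G *v x - a) + t *\<^sub>R ?d" unfolding Gz by simp
      moreover have "(norm (u + t *\<^sub>R ?d))\<^sup>2 = (norm u)\<^sup>2 + 2 * t * (?d \<bullet> u) + t\<^sup>2 * (?d \<bullet> ?d)" for u
        unfolding power2_norm_eq_inner
        by (simp only: inner_add_left inner_add_right inner_scaleR_left inner_scaleR_right
            inner_commute[of u ?d] power2_eq_square) (simp add: algebra_simps)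
      moreover have "?d \<bullet> (G *v x - a) = - (?d \<bullet> (a - G *v x))"
        by (metis inner_minus_right minus_diff_eq)
      ultimately show ?thesis by (simp only: mult_minus_right)
    qed
    have lz: "l \<bullet> (G *v z) = l \<bullet> (G *v x) + t * (?d \<bullet> l)"
      unfolding Gz by (simp only: inner_add_right inner_scaleR_right inner_commute[of l ?d])
    have "0 \<le> t * (f y - f x) - t * (?d \<bullet> l) - \<beta> * t * (?d \<bullet> (a - G *v x)) + \<beta> / 2 * t\<^sup>2 * (?d \<bullet> ?d)"
      using min fz unfolding lz sq by (simp only: ring_distribs)
    also have "\<dots> = t * (f y - f x + t * (\<beta> / 2 * (?d \<bullet> ?d)) - ?d \<bullet> (l + \<beta> *\<^sub>R (a - G *v x)))"
      by (simp only: inner_add_right inner_scaleR_right power2_eq_square ring_distribs) simp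
    finally show ?thesis
      using \<open>0 < t\<close> by (simp add: zero_le_mult_iff)
  qed
  have "((\<lambda>t. f y - f x + t * (\<beta> / 2 * (?d \<bullet> ?d))) \<longlongrightarrow> f y - f x + 0 * (\<beta> / 2 * (?d \<bullet> ?d))) (at_right 0)"
    by (intro tendsto_intros)
  moreover have "eventually (\<lambda>t. ?d \<bullet> (l + \<beta> *\<^sub>R (a - G *v x)) \<le> f y - f x + t * (\<beta> / 2 * (?d \<bullet> ?d))) (at_right 0)"
    using le by (auto simp: eventually_at_right[of 0 1] intro!: exI[of _ 1])
  ultimately show ?thesis
    by (intro tendsto_lowerbound[where F = "at_right (0::real)"]) auto
qed

text \<open>
  The perturbation is the mismatch between what the step computes and what the variational
  inequality asks of the prediction. The optimality condition of subproblem \<open>i\<close> contains the current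
  multiplier and the penalty gradient where the operator has the predicted multiplier; the
  difference is row \<open>i\<close> of \<open>Q (\<xi> - P v)\<close>. The multiplier update contains the residual of the current
  blocks where the operator has the residual of the predicted ones; this gives the last row.
\<close>

lemma psalm_step_solves_VI:
  fixes \<theta> :: "'p::finite \<Rightarrow> real ^ 'n::finite \<Rightarrow> real" and A :: "'p \<Rightarrow> real ^ 'n ^ 'm::finite"
  assumes "\<beta> > 0"
    and convex: "\<And>i. convex_on (S i) (\<theta> i)" "\<And>i. X i \<subseteq> S i" "\<And>i. convex (X i)"
    and step: "psalm_step \<theta> X A b \<beta> \<alpha> \<xi> \<xi>'"
  obtains v where "solves_VI \<theta> X A b (Q_mat \<beta> *v (\<xi> - P_map A v)) v"
    and "\<xi>' = \<xi> - \<alpha> *\<^sub>R (M_mat \<beta> *v (\<xi> - P_map A v))"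
proof -
  let ?l = "block None \<xi>" and ?a = "\<lambda>i. block (Some i) \<xi>"
  obtain xt :: "('n, 'p) primal" and lt where
    min: "\<And>i. is_arg_min
             (\<lambda>x. \<theta> i x - ?l \<bullet> (A i *v x) + \<beta> / 2 * (norm (A i *v x - ?a i))\<^sup>2)
             (\<lambda>x. x \<in> X i) (xt $ i)"
    and lt: "lt = ?l - \<beta> *\<^sub>R ((\<Sum>i\<in>UNIV. ?a i) - b)"
    and next_eq: "\<xi>' = \<xi> - \<alpha> *\<^sub>R (M_mat \<beta> *v (\<xi> - P_map A (xt, lt)))"
    using step unfolding psalm_step_def by blast
  let ?v = "(xt, lt)"
  define g where "g = Q_mat \<beta> *v (\<xi> - P_map A ?v)"
  have "(P_map A w - P_map A ?v) \<bullet> g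
      \<le> total_objective \<theta> (fst w) - total_objective \<theta> (fst ?v) + (w - ?v) \<bullet> VI_op A b ?v"
    if w: "w \<in> Omega X" for w
  proof -
    let ?d = "\<lambda>i. A i *v (fst w $ i) - A i *v (xt $ i)"
    have g_Some: "block (Some i) g = (?l + \<beta> *\<^sub>R (?a i - A i *v (xt $ i))) - lt" for i
      by (simp add: g_def block_Q_mat block_diff block_P_map del: matrix_vector_mult_diff_distrib)
    have g_None: "block None g = (\<Sum>i\<in>UNIV. A i *v (xt $ i)) - b"
    proof -
      have "(1 / \<beta>) *\<^sub>R (?l - lt) = (\<Sum>i\<in>UNIV. ?a i) - b"
        using \<open>\<beta> > 0\<close> by (simp add: lt)
      then show ?thesis
        by (simp add: g_def block_Q_mat block_diff block_P_map sum_subtractf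
            del: matrix_vector_mult_diff_distrib)
    qed
    have "?d i \<bullet> block (Some i) g \<le> \<theta> i (fst w $ i) - \<theta> i (xt $ i) - ?d i \<bullet> lt" for i
      using prox_optimality[OF convex min[of i], of "fst w $ i"] w
      unfolding g_Some by (simp add: Omega_def inner_diff_right)
    then have "(\<Sum>i\<in>UNIV. ?d i \<bullet> block (Some i) g)
        \<le> (\<Sum>i\<in>UNIV. \<theta> i (fst w $ i) - \<theta> i (xt $ i) - ?d i \<bullet> lt)"
      by (rule sum_mono)
    then show ?thesis
      unfolding inner_blockvec[of _ g] inner_VI_op
      by (simp add: block_diff block_P_map g_None total_objective_def
          sum_subtractf matrix_vector_mult_diff_distrib)
  qed
  moreover have "?v \<in> Omega X"
    using min by (simp add: Omega_def is_arg_min_def)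
  ultimately have "solves_VI \<theta> X A b g ?v"
    by (simp add: solves_VI_def)
  then show thesis using next_eq unfolding g_def by (rule that)
qed

section \<open>The convergence rate\<close>

theorem theorem5p3:
  fixes J :: "'p::finite \<Rightarrow> 'n::finite set"
    and \<theta> :: "'p \<Rightarrow> real ^ 'n \<Rightarrow> real"
    and X :: "'p \<Rightarrow> (real ^ 'n) set"
    and A :: "'p \<Rightarrow> real ^ 'n ^ 'm::finite"
    and b :: "real ^ 'm"
    and \<alpha> \<beta> :: real
    and \<xi> :: "nat \<Rightarrow> real ^ ('p option \<times> 'm)"
    and N :: nat
  assumes "CARD('p) \<ge> 2"
    and "\<And>i. J i \<noteq> {}"
    and "\<And>i. closed_fun_on (coord_space (J i)) (\<theta> i)"
    and "\<And>i. proper_on (coord_space (J i)) (\<lambda>x. ereal (\<theta> i x))"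
    and "\<And>i. convex_on (coord_space (J i)) (\<theta> i)"
    and "\<And>i. X i \<subseteq> coord_space (J i)"
    and "\<And>i. closed (X i)"
    and "\<And>i. convex (X i)"
    and "\<And>i. full_column_rank_on (J i) (A i)"
    and "\<exists>x. is_arg_min (total_objective \<theta>) (feasible X A b) x"
    and "\<beta> > 0"
    and "\<alpha> \<in> {0<..<2}"
    and "\<And>k. psalm_step \<theta> X A b \<beta> \<alpha> (\<xi> k) (\<xi> (Suc k))"
    and "N > 0"
  shows "\<forall>\<xi>s \<in> Xi_star \<theta> X A b.
    norm_sq (H_mat \<beta>) (\<xi> N - \<xi> (N + 1))
      \<le> \<alpha> / ((2 - \<alpha>) * (real N + 1)) * norm_sq (H_mat \<beta>) (\<xi> 0 - \<xi>s)"
proof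
  fix \<xi>s
  assume "\<xi>s \<in> Xi_star \<theta> X A b"
  then obtain ws where ws: "solves_VI \<theta> X A b 0 ws" and \<xi>s: "\<xi>s = P_map A ws"
    by (auto simp: Xi_star_def Omega_star_solves_VI)
  have "\<exists>v. solves_VI \<theta> X A b (Q_mat \<beta> *v (\<xi> k - P_map A v)) v \<and>
      \<xi> (Suc k) = \<xi> k - \<alpha> *\<^sub>R (M_mat \<beta> *v (\<xi> k - P_map A v))" for k
    using psalm_step_solves_VI[OF assms(11) assms(5,6,8) assms(13)[of k]] by metis
  then obtain v where
    v: "\<And>k. solves_VI \<theta> X A b (Q_mat \<beta> *v (\<xi> k - P_map A (v k))) (v k)"
    and step: "\<And>k. \<xi> (Suc k) = \<xi> k - \<alpha> *\<^sub>R (M_mat \<beta> *v (\<xi> k - P_map A (v k)))"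
    by metis
  interpret prediction_correction "Q_mat \<beta>" "D_mat \<beta>" "M_mat \<beta>" "H_mat \<beta> :: ('p, 'm) blockmat"
    using assms(11) by (rule prediction_correction_psalm)
  show "norm_sq (H_mat \<beta>) (\<xi> N - \<xi> (N + 1))
      \<le> \<alpha> / ((2 - \<alpha>) * (real N + 1)) * norm_sq (H_mat \<beta>) (\<xi> 0 - \<xi>s)"
    unfolding Suc_eq_plus1[symmetric]
  proof (rule prediction_correction_rate)
    let ?e = "\<lambda>k. \<xi> k - P_map A (v k)"
    show "\<xi> (Suc k) = \<xi> k - \<alpha> *\<^sub>R (M_mat \<beta> *v ?e k)" for k
      by (rule step)
    show "(\<xi> k - ?e k - \<xi>s) \<bullet> (Q_mat \<beta> *v ?e k) \<ge> 0" for k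
      using solves_VI_monotone[OF v[of k] ws] by (simp only: \<xi>s diff_diff_eq2 add_diff_cancel_left' diff_zero)
    show "((\<xi> k - ?e k) - (\<xi> (Suc k) - ?e (Suc k))) \<bullet> (Q_mat \<beta> *v ?e k - Q_mat \<beta> *v ?e (Suc k)) \<ge> 0" for k
      using solves_VI_monotone[OF v[of k] v[of "Suc k"]] by (simp only: diff_diff_eq2 add_diff_cancel_left')
  qed (use assms(12) in auto)
qed

end
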